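(* Let $k\ge 1$ and $n\geq 2$ be integers, let $r\in\mathbb{C}$, and let $\mathbf{P}_n=\mathrm{Circ}_r(P_{k,0},P_{k,1},\ldots,P_{k,n-1})$. Then $$\sqrt{\mathcal{S}^{(2)}_{n-1}+\frac{|r|^2-1}{n}\,\mathcal{W}^{(2)}_{n-1}}\;\leq\;\|\mathbf{P}_n\|_2\;\leq\;\max\{|r|,1\}\,\mathcal{S}^{(1)}_{n-1}.$$
   Context: For an integer $k\geq 1$, the generalized $k$-Pell-Tribonacci sequence $(P_{k,n})_{n\ge 0}$ is defined by $P_{k,0}=0$, $P_{k,1}=1$, $P_{k,2}=2k$ and $P_{k,n}=2kP_{k,n-1}+kP_{k,n-2}+P_{k,n-3}$ for $n\geq 3$. Set $\mathcal{S}^{(1)}_n=\sum_{i=0}^n P_{k,i}$, $\mathcal{S}^{(2)}_n=\sum_{i=0}^n P_{k,i}^2$, $\mathcal{W}^{(2)}_n=\sum_{i=0}^n iP_{k,i}^2$. For $n\ge 2$, $r\in\mathbb{C}$ and $a_0,\dots,a_{n-1}\in\mathbb{C}$, the $r$-circulant matrix $\mathrm{Circ}_r(a_0,\dots,a_{n-1})$ is the $n\times n$ matrix whose $(i,j)$ entry ($1\le i,j\le n$) is $a_{j-i}$ if $j\ge i$ and $r\,a_{n+j-i}$ if $j<i$. $\|A\|_2$ denotes the spectral norm of $A\in\mathbb{C}^{n\times n}$, i.e. the square root of the largest eigenvalue of $A^*A$ (the largest singular value of $A$), where $A^*$ is the conjugate transpose. *)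

theory Defs
  imports
    Complex_Main
    "Jordan_Normal_Form.Schur_Decomposition"
    "Jordan_Normal_Form.Spectral_Radius"
begin

fun pell_trib :: "nat \<Rightarrow> nat \<Rightarrow> nat" where
  "pell_trib k 0 = 0"
| "pell_trib k (Suc 0) = 1"
| "pell_trib k (Suc (Suc 0)) = 2 * k"
| "pell_trib k (Suc (Suc (Suc n))) =
     2 * k * pell_trib k (Suc (Suc n)) + k * pell_trib k (Suc n) + pell_trib k n"

definition S1 :: "nat \<Rightarrow> nat \<Rightarrow> nat" where
  "S1 k n = (\<Sum>i=0..n. pell_trib k i)"

definition S2 :: "nat \<Rightarrow> nat \<Rightarrow> nat" where
  "S2 k n = (\<Sum>i=0..n. (pell_trib k i)\<^sup>2)"

definition W2 :: "nat \<Rightarrow> nat \<Rightarrow> nat" where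
  "W2 k n = (\<Sum>i=0..n. i * (pell_trib k i)\<^sup>2)"

(* Indices run over 0..<n instead of 1..n; the entries depend only on differences of indices. *)
definition r_circulant :: "nat \<Rightarrow> complex \<Rightarrow> (nat \<Rightarrow> complex) \<Rightarrow> complex mat" where
  "r_circulant n r a =
     mat n n (\<lambda>(i, j). if i \<le> j then a (j - i) else r * a (n + j - i))"

(* The matrix A^* A is Hermitian and positive semidefinite, so all its eigenvalues are
   real; the Max ranges over its full spectrum, which is finite, and nonempty whenever A is a
   square matrix of positive size. *)
definition spectral_norm :: "complex mat \<Rightarrow> real" where
  "spectral_norm A = sqrt (Max {x :: real. eigenvalue (mat_adjoint A * A) (complex_of_real x)})"

end

theory Submission
  imports Defs
begin

text \<open>
  The eigenvalues of \<open>A\<^sup>* A\<close> are real and add up to its trace, which is the sum of the squared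
  moduli of the entries of \<open>A\<close>; so the largest one is at least the average \<open>\<parallel>A\<parallel>\<^sub>F\<^sup>2 / n\<close>. For the
  circulant matrix this average is exactly the radicand on the left. In the other direction, an
  eigenvector of \<open>A\<^sup>* A\<close> measured in the maximum norm shows that the eigenvalue is at most the
  product of the largest row sum and the largest column sum of \<open>A\<close> (taken over moduli of entries),
  and both are at most \<open>max |r| 1\<close> times the sum of the sequence.
\<close>

section \<open>Adjoints and the real spectrum of \<open>mat_adjoint A * A\<close>\<close>

lemma mat_adjoint_carrier:
  "A \<in> carrier_mat n n \<Longrightarrow> mat_adjoint A \<in> carrier_mat n n"
  unfolding mat_adjoint_def by (auto intro!: mat_of_rows_carrier)

lemma index_mat_adjoint:
  fixes A :: "complex mat"
  assumes "A \<in> carrier_mat n n" "i < n" "j < n"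
  shows "mat_adjoint A $$ (i, j) = cnj (A $$ (j, i))"
  using assms unfolding mat_adjoint_def by (auto simp: mat_of_rows_index)

lemma index_mult_mat_vec_sum:
  assumes "A \<in> carrier_mat n m" "v \<in> carrier_vec m" "i < n"
  shows "(A *\<^sub>v v) $ i = (\<Sum>j=0..<m. A $$ (i, j) * v $ j)"
  using assms by (auto simp: scalar_prod_def intro!: sum.cong)

text \<open>Pairing the eigenvector equation with \<open>v\<close> shows that \<open>e\<close> times
  the squared norm of \<open>v\<close> is the squared norm of \<open>A *\<^sub>v v\<close>. Since
  \<open>spectral_norm\<close> only collects real eigenvalues, this is what places every complex
  eigenvalue in its set.\<close>

lemma eigenvalue_adjoint_mult_real:
  fixes A :: "complex mat"
  assumes A: "A \<in> carrier_mat n n" and e: "eigenvalue (mat_adjoint A * A) e"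
  shows "e \<in> \<real>"
proof -
  note adj = mat_adjoint_carrier[OF A]
  from e adj A obtain v where v: "v \<in> carrier_vec n" and v0: "v \<noteq> 0\<^sub>v n"
    and ev: "(mat_adjoint A * A) *\<^sub>v v = e \<cdot>\<^sub>v v"
    unfolding eigenvalue_def eigenvector_def by auto
  define w where "w = A *\<^sub>v v"
  have w: "w \<in> carrier_vec n" using A v unfolding w_def by simp
  have ew: "mat_adjoint A *\<^sub>v w = e \<cdot>\<^sub>v v"
    using ev adj A v unfolding w_def by (simp add: assoc_mult_mat_vec)
  have "e * of_real (\<Sum>i=0..<n. (cmod (v $ i))\<^sup>2)
      = (\<Sum>i=0..<n. cnj (v $ i) * (mat_adjoint A *\<^sub>v w) $ i)"
    unfolding ew of_real_sum sum_distrib_left complex_norm_square using v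
    by (intro sum.cong) (auto simp del: of_real_power)
  also have "\<dots> = (\<Sum>i=0..<n. \<Sum>j=0..<n. cnj (v $ i) * (cnj (A $$ (j, i)) * w $ j))"
    using adj w A
    by (intro sum.cong) (simp_all del: index_mult_mat_vec
        add: index_mult_mat_vec_sum index_mat_adjoint sum_distrib_left)
  \<comment> \<open>Exchanging the sums moves the adjoint from \<open>w\<close> to \<open>A\<close>
    acting on \<open>v\<close>, which is \<open>w\<close> again.\<close>
  also have "\<dots> = (\<Sum>j=0..<n. w $ j * cnj (\<Sum>i=0..<n. A $$ (j, i) * v $ i))"
    unfolding cnj_sum sum_distrib_left
    by (subst sum.swap) (auto intro!: sum.cong)
  also have "\<dots> = (\<Sum>j=0..<n. w $ j * cnj (w $ j))"
    using A v unfolding w_def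
    by (intro sum.cong) (simp_all del: index_mult_mat_vec add: index_mult_mat_vec_sum)
  also have "\<dots> = of_real (\<Sum>j=0..<n. (cmod (w $ j))\<^sup>2)"
    unfolding of_real_sum by (simp only: complex_norm_square)
  finally have eq: "e * of_real (\<Sum>i=0..<n. (cmod (v $ i))\<^sup>2)
      = of_real (\<Sum>j=0..<n. (cmod (w $ j))\<^sup>2)" .
  have "(\<Sum>i=0..<n. (cmod (v $ i))\<^sup>2) \<noteq> 0"
    using v v0 by (auto simp: sum_nonneg_eq_0_iff)
  with eq have "e = of_real ((\<Sum>j=0..<n. (cmod (w $ j))\<^sup>2) / (\<Sum>i=0..<n. (cmod (v $ i))\<^sup>2))"
    by (metis nonzero_eq_divide_eq of_real_divide of_real_eq_0_iff)
  thus ?thesis by (metis Reals_of_real)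
qed

text \<open>Finiteness is what gives \<open>Max\<close> in \<open>spectral_norm\<close> its intended
  meaning. The set is the preimage of the finite complex spectrum under an injection.\<close>

lemma finite_real_eigenvalues:
  fixes A :: "complex mat"
  assumes "A \<in> carrier_mat n n"
  shows "finite {x :: real. eigenvalue A (complex_of_real x)}"
proof -
  have "inj complex_of_real" by (simp add: inj_on_def)
  from finite_vimageI[OF card_finite_spectrum(1)[OF assms] this]
  show ?thesis by (simp add: spectrum_def vimage_def)
qed

section \<open>The trace as a sum of eigenvalues\<close>

lemma sum_diag_mult_comm:
  fixes A B :: "'a :: comm_semiring_0 mat"
  assumes "A \<in> carrier_mat n m" "B \<in> carrier_mat m n"
  shows "(\<Sum>i=0..<n. (A * B) $$ (i, i)) = (\<Sum>j=0..<m. (B * A) $$ (j, j))"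
proof -
  have "(\<Sum>i=0..<n. (A * B) $$ (i, i)) = (\<Sum>i=0..<n. \<Sum>j=0..<m. A $$ (i, j) * B $$ (j, i))"
    using assms by (auto simp: scalar_prod_def intro!: sum.cong)
  also have "\<dots> = (\<Sum>j=0..<m. \<Sum>i=0..<n. B $$ (j, i) * A $$ (i, j))"
    by (subst sum.swap) (simp add: mult.commute)
  also have "\<dots> = (\<Sum>j=0..<m. (B * A) $$ (j, j))"
    using assms by (auto simp: scalar_prod_def intro!: sum.cong)
  finally show ?thesis .
qed

text \<open>Schur triangularization makes \<open>A\<close> similar to an upper triangular
  \<open>B\<close>. The diagonal of \<open>B\<close> consists of roots of the common characteristic
  polynomial, and similarity preserves the trace.\<close>

lemma sum_diag_eq_sum_eigenvalues:
  fixes A :: "complex mat"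
  assumes A: "A \<in> carrier_mat n n"
  obtains f where "\<And>i. i < n \<Longrightarrow> eigenvalue A (f i)"
    and "(\<Sum>i=0..<n. A $$ (i, i)) = (\<Sum>i=0..<n. f i)"
proof -
  from char_poly_factorized[OF A] obtain es where
    "char_poly A = (\<Prod>a\<leftarrow>es. [:- a, 1:])" by blast
  from schur_decomposition_exists[OF A this] obtain B where
    B: "B \<in> carrier_mat n n" and ut: "upper_triangular B" and sim: "similar_mat A B" by blast
  from sim obtain P Q where "similar_mat_wit A B P Q" unfolding similar_mat_def by blast
  note wit = similar_mat_witD2[OF A this]
  have "eigenvalue A (B $$ (i, i))" if "i < n" for i
  proof -
    have "poly (char_poly B) (B $$ (i, i)) = 0"
      unfolding char_poly_upper_triangular[OF B ut] poly_prod_list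
      using B that by (force simp: diag_mat_def prod_list_zero_iff)
    thus ?thesis
      using eigenvalue_root_char_poly[OF A] char_poly_similar[OF sim] by simp
  qed
  moreover have "(\<Sum>i=0..<n. A $$ (i, i)) = (\<Sum>i=0..<n. B $$ (i, i))"
  proof -
    \<comment> \<open>Here \<open>A\<close> is \<open>(P * B) * Q\<close>; after the factors are
      commuted, \<open>Q * P\<close> cancels to the identity.\<close>
    have "(\<Sum>i=0..<n. A $$ (i, i)) = (\<Sum>i=0..<n. (Q * (P * B)) $$ (i, i))"
      unfolding wit(3) using wit by (intro sum_diag_mult_comm) auto
    also have "Q * (P * B) = B"
      using wit B by (metis assoc_mult_mat left_mult_one_mat)
    finally show ?thesis .
  qed
  ultimately show ?thesis by (rule that)
qed

section \<open>Bounds for the spectral norm of a square matrix\<close>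

lemma spectral_norm_ge_frobenius:
  fixes A :: "complex mat"
  assumes A: "A \<in> carrier_mat n n" and n: "n > 0"
  shows "sqrt ((\<Sum>i=0..<n. \<Sum>j=0..<n. (cmod (A $$ (i, j)))\<^sup>2) / real n) \<le> spectral_norm A"
proof -
  let ?B = "mat_adjoint A * A"
  let ?E = "{x :: real. eigenvalue ?B (complex_of_real x)}"
  have B: "?B \<in> carrier_mat n n" using mat_adjoint_carrier[OF A] A by simp
  obtain f where f: "\<And>i. i < n \<Longrightarrow> eigenvalue ?B (f i)"
    and tr: "(\<Sum>i=0..<n. ?B $$ (i, i)) = (\<Sum>i=0..<n. f i)"
    using sum_diag_eq_sum_eigenvalues[OF B] by blast
  \<comment> \<open>As \<open>f i\<close> is real, it equals its real part, which therefore lies in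
    \<open>?E\<close>.\<close>
  have le: "Re (f i) \<le> Max ?E" if "i < n" for i
    using finite_real_eigenvalues[OF B] f[OF that] eigenvalue_adjoint_mult_real[OF A f[OF that]]
    by (intro Max_ge) simp_all
  have "(\<Sum>i=0..<n. ?B $$ (i, i))
      = (\<Sum>i=0..<n. \<Sum>j=0..<n. of_real ((cmod (A $$ (j, i)))\<^sup>2))"
    using A mat_adjoint_carrier[OF A] unfolding complex_norm_square
    by (intro sum.cong) (auto simp: scalar_prod_def index_mat_adjoint mult.commute intro!: sum.cong)
  also have "\<dots> = of_real (\<Sum>i=0..<n. \<Sum>j=0..<n. (cmod (A $$ (i, j)))\<^sup>2)"
    by (subst sum.swap) simp
  finally have "(\<Sum>i=0..<n. \<Sum>j=0..<n. (cmod (A $$ (i, j)))\<^sup>2) = (\<Sum>i=0..<n. Re (f i))"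
    unfolding tr by (metis Re_complex_of_real Re_sum)
  also have "\<dots> \<le> (\<Sum>i=0..<n. Max ?E)"
    using le by (intro sum_mono) simp
  finally have "(\<Sum>i=0..<n. \<Sum>j=0..<n. (cmod (A $$ (i, j)))\<^sup>2) / real n \<le> Max ?E"
    using n by (simp add: field_simps)
  thus ?thesis unfolding spectral_norm_def by (rule real_sqrt_le_mono)
qed

lemma cmod_mult_mat_vec_le:
  fixes A :: "complex mat"
  assumes "A \<in> carrier_mat n m" "v \<in> carrier_vec m" "i < n"
    and row: "(\<Sum>j=0..<m. cmod (A $$ (i, j))) \<le> c"
    and v: "\<And>j. j < m \<Longrightarrow> cmod (v $ j) \<le> b" and b: "0 \<le> b"
  shows "cmod ((A *\<^sub>v v) $ i) \<le> c * b"
proof -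
  have "cmod ((A *\<^sub>v v) $ i) \<le> (\<Sum>j=0..<m. cmod (A $$ (i, j)) * cmod (v $ j))"
    unfolding index_mult_mat_vec_sum[OF assms(1-3)] norm_mult[symmetric] by (rule norm_sum)
  also have "\<dots> \<le> (\<Sum>j=0..<m. cmod (A $$ (i, j)) * b)"
    using v by (intro sum_mono mult_left_mono) auto
  also have "\<dots> \<le> c * b"
    unfolding sum_distrib_right[symmetric] using row b by (rule mult_right_mono)
  finally show ?thesis .
qed

text \<open>In the maximum norm \<open>A\<close> stretches a vector by at most its largest row sum.
  The row sums of the adjoint are the column sums of \<open>A\<close>, so
  \<open>mat_adjoint A * A\<close> stretches by at most \<open>c\<^sup>2\<close>.\<close>

lemma spectral_norm_le_row_col_sums:
  fixes A :: "complex mat"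
  assumes A: "A \<in> carrier_mat n n" and n: "n > 0"
    and row: "\<And>i. i < n \<Longrightarrow> (\<Sum>j=0..<n. cmod (A $$ (i, j))) \<le> c"
    and col: "\<And>j. j < n \<Longrightarrow> (\<Sum>i=0..<n. cmod (A $$ (i, j))) \<le> c"
  shows "spectral_norm A \<le> c"
proof -
  let ?B = "mat_adjoint A * A"
  let ?E = "{x :: real. eigenvalue ?B (complex_of_real x)}"
  note adj = mat_adjoint_carrier[OF A]
  have B: "?B \<in> carrier_mat n n" using adj A by simp
  have "0 \<le> (\<Sum>j=0..<n. cmod (A $$ (0, j)))" by (intro sum_nonneg) simp
  with row[OF n] have c: "0 \<le> c" by linarith
  have bound: "x \<le> c\<^sup>2" if "x \<in> ?E" for x
  proof -
    from that adj A obtain v where v: "v \<in> carrier_vec n" and v0: "v \<noteq> 0\<^sub>v n"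
      and ev: "?B *\<^sub>v v = of_real x \<cdot>\<^sub>v v"
      unfolding eigenvalue_def eigenvector_def by auto
    \<comment> \<open>The eigenvector equation will be read off at a coordinate \<open>m\<close> of
      largest modulus \<open>b\<close>; as \<open>b\<close> is positive, it can then be
      cancelled.\<close>
    let ?V = "(\<lambda>j. cmod (v $ j)) ` {0..<n}"
    define b where "b = Max ?V"
    have "b \<in> ?V" unfolding b_def using n by (intro Max_in) auto
    then obtain m where m: "m < n" and b: "b = cmod (v $ m)" by auto
    have vb: "cmod (v $ j) \<le> b" if "j < n" for j
      unfolding b_def using that by (intro Max_ge) auto
    have "b \<noteq> 0"
    proof
      assume "b = 0"
      hence "v = 0\<^sub>v n" using vb v by (intro eq_vecI) auto
      with v0 show False by simp
    qed
    with b have b0: "b > 0" by simp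
    have Av: "cmod ((A *\<^sub>v v) $ j) \<le> c * b" if "j < n" for j
      using b0 by (intro cmod_mult_mat_vec_le[OF A v that row[OF that] vb]) auto
    have "(\<Sum>j=0..<n. cmod (mat_adjoint A $$ (m, j))) \<le> c"
      using col[OF m] A m by (simp add: index_mat_adjoint)
    hence "cmod ((mat_adjoint A *\<^sub>v (A *\<^sub>v v)) $ m) \<le> c * (c * b)"
      using Av c b0 A v by (intro cmod_mult_mat_vec_le[OF adj _ m]) auto
    also have "mat_adjoint A *\<^sub>v (A *\<^sub>v v) = of_real x \<cdot>\<^sub>v v"
      using ev adj A v by (simp add: assoc_mult_mat_vec)
    finally have "\<bar>x\<bar> * b \<le> c\<^sup>2 * b"
      using m v b by (simp add: norm_mult power2_eq_square mult.assoc)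
    thus ?thesis using b0 by simp
  qed
  \<comment> \<open>A bound on all members bounds \<open>Max ?E\<close> only if there is a member:
    the complex spectrum is nonempty, and all of it is real.\<close>
  have "?E \<noteq> {}"
  proof -
    from spectrum_non_empty[OF B n] obtain e where e: "eigenvalue ?B e"
      unfolding spectrum_def by auto
    with eigenvalue_adjoint_mult_real[OF A] have "e = of_real (Re e)" by simp
    with e show ?thesis by (metis (mono_tags, lifting) empty_iff mem_Collect_eq)
  qed
  hence "Max ?E \<le> c\<^sup>2"
    using bound finite_real_eigenvalues[OF B] by simp
  thus ?thesis unfolding spectral_norm_def using c by (metis real_le_lsqrt real_sqrt_le_mono real_sqrt_unique)
qed

section \<open>Row sums, column sums and Frobenius norm of r-circulant matrices\<close>

text \<open>A row runs through every index below \<open>n\<close> exactly once, cut at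
  \<open>n - i\<close> into a part without and a part with the factor \<open>r\<close>. Keeping
  \<open>f\<close> and \<open>g\<close> arbitrary lets this serve both for moduli and for their
  squares.\<close>

lemma sum_circulant_row:
  fixes f g :: "nat \<Rightarrow> 'a :: comm_monoid_add"
  assumes "i < n"
  shows "(\<Sum>j=0..<n. if i \<le> j then f (j - i) else g (n + j - i))
    = sum f {0..<n - i} + sum g {n - i..<n}"
proof -
  have "(\<Sum>j=0..<n. if i \<le> j then f (j - i) else g (n + j - i))
      = (\<Sum>j=0..<i. g (n + j - i)) + (\<Sum>j=i..<n. f (j - i))"
    using assms by (subst sum.atLeastLessThan_concat[of 0 i n, symmetric]) auto
  also have "(\<Sum>j=i..<n. f (j - i)) = sum f {0..<n - i}"
    using assms by (intro sum.reindex_bij_witness[of _ "\<lambda>j. j + i" "\<lambda>j. j - i"]) auto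
  also have "(\<Sum>j=0..<i. g (n + j - i)) = sum g {n - i..<n}"
    using assms by (intro sum.reindex_bij_witness[of _ "\<lambda>j. j + i - n" "\<lambda>j. n + j - i"]) auto
  finally show ?thesis by (simp add: add.commute)
qed

lemma sum_circulant_col:
  fixes f g :: "nat \<Rightarrow> 'a :: comm_monoid_add"
  assumes "j < n"
  shows "(\<Sum>i=0..<n. if i \<le> j then f (j - i) else g (n + j - i))
    = sum f {0..<Suc j} + sum g {Suc j..<n}"
proof -
  have "(\<Sum>i=0..<n. if i \<le> j then f (j - i) else g (n + j - i))
      = (\<Sum>i=0..<Suc j. f (j - i)) + (\<Sum>i=Suc j..<n. g (n + j - i))"
    using assms by (subst sum.atLeastLessThan_concat[of 0 "Suc j" n, symmetric]) auto
  \<comment> \<open>Both reindexings are reflections of a range onto itself, hence their own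
    inverses.\<close>
  also have "(\<Sum>i=0..<Suc j. f (j - i)) = sum f {0..<Suc j}"
    by (intro sum.reindex_bij_witness[of _ "\<lambda>i. j - i" "\<lambda>i. j - i"]) auto
  also have "(\<Sum>i=Suc j..<n. g (n + j - i)) = sum g {Suc j..<n}"
    using assms by (intro sum.reindex_bij_witness[of _ "\<lambda>i. n + j - i" "\<lambda>i. n + j - i"]) auto
  finally show ?thesis .
qed

lemma r_circulant_carrier: "r_circulant n r a \<in> carrier_mat n n"
  unfolding r_circulant_def by simp

lemma spectral_norm_r_circulant_le:
  assumes "n > 0"
  shows "spectral_norm (r_circulant n r a) \<le> max (cmod r) 1 * (\<Sum>i=0..<n. cmod (a i))"
proof (rule spectral_norm_le_row_col_sums[OF r_circulant_carrier assms])
  let ?M = "max (cmod r) 1"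
  \<comment> \<open>The cut \<open>m\<close> stays arbitrary so that \<open>n - i\<close> covers the
    rows and \<open>Suc i\<close> the columns; \<open>1\<close> and \<open>cmod r\<close> are both
    at most \<open>?M\<close>.\<close>
  have le: "sum (\<lambda>l. cmod (a l)) {0..<m} + (\<Sum>l=m..<n. cmod (r * a l))
      \<le> ?M * (\<Sum>l=0..<n. cmod (a l))" if "m \<le> n" for m
  proof -
    have "(\<Sum>l=0..<m. cmod (a l)) \<le> (\<Sum>l=0..<m. ?M * cmod (a l))"
      by (intro sum_mono) (simp add: mult_le_cancel_right1)
    moreover have "(\<Sum>l=m..<n. cmod (r * a l)) \<le> (\<Sum>l=m..<n. ?M * cmod (a l))"
      unfolding norm_mult by (intro sum_mono mult_right_mono) auto
    ultimately show ?thesis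
      unfolding sum_distrib_left
      using sum.atLeastLessThan_concat[of 0 m n "\<lambda>l. ?M * cmod (a l)"] that by simp
  qed
  fix i assume i: "i < n"
  have "(\<Sum>j=0..<n. cmod (r_circulant n r a $$ (i, j)))
      = (\<Sum>j=0..<n. if i \<le> j then cmod (a (j - i)) else cmod (r * a (n + j - i)))"
    using i by (intro sum.cong) (auto simp: r_circulant_def)
  with le[of "n - i"] show "(\<Sum>j=0..<n. cmod (r_circulant n r a $$ (i, j))) \<le> ?M * (\<Sum>i=0..<n. cmod (a i))"
    unfolding sum_circulant_row[OF i, of "\<lambda>l. cmod (a l)" "\<lambda>l. cmod (r * a l)"] by simp
  have "(\<Sum>j=0..<n. cmod (r_circulant n r a $$ (j, i)))
      = (\<Sum>j=0..<n. if j \<le> i then cmod (a (i - j)) else cmod (r * a (n + i - j)))"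
    using i by (intro sum.cong) (auto simp: r_circulant_def)
  with le[of "Suc i"] i show "(\<Sum>j=0..<n. cmod (r_circulant n r a $$ (j, i))) \<le> ?M * (\<Sum>i=0..<n. cmod (a i))"
    unfolding sum_circulant_col[OF i, of "\<lambda>l. cmod (a l)" "\<lambda>l. cmod (r * a l)"] by simp
qed

text \<open>The term \<open>a l\<close> occurs \<open>n - l\<close> times without and \<open>l\<close> times with the factor \<open>r\<close>.\<close>

lemma frobenius_r_circulant:
  "(\<Sum>i=0..<n. \<Sum>j=0..<n. (cmod (r_circulant n r a $$ (i, j)))\<^sup>2)
    = (\<Sum>l=0..<n. (real (n - l) + real l * (cmod r)\<^sup>2) * (cmod (a l))\<^sup>2)"
proof -
  let ?q = "\<lambda>l. (cmod (a l))\<^sup>2"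
  have "(\<Sum>i=0..<n. \<Sum>j=0..<n. (cmod (r_circulant n r a $$ (i, j)))\<^sup>2)
      = (\<Sum>i=0..<n. \<Sum>j=0..<n. if i \<le> j then ?q (j - i) else (cmod r)\<^sup>2 * ?q (n + j - i))"
    by (intro sum.cong) (auto simp: r_circulant_def norm_mult power_mult_distrib)
  also have "\<dots> = (\<Sum>i=0..<n. sum ?q {0..<n - i} + (\<Sum>l=n - i..<n. (cmod r)\<^sup>2 * ?q l))"
    by (intro sum.cong refl sum_circulant_row) simp
  \<comment> \<open>Merging both parts into one range independent of \<open>i\<close> permits
    exchanging the sums. The condition is symmetric: \<open>l < n - i\<close> and
    \<open>i < n - l\<close> both say that \<open>i + l < n\<close>.\<close>
  also have "\<dots> = (\<Sum>i=0..<n. \<Sum>l=0..<n. if l < n - i then ?q l else (cmod r)\<^sup>2 * ?q l)"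
  proof (intro sum.cong refl)
    fix i
    show "sum ?q {0..<n - i} + (\<Sum>l=n - i..<n. (cmod r)\<^sup>2 * ?q l)
        = (\<Sum>l=0..<n. if l < n - i then ?q l else (cmod r)\<^sup>2 * ?q l)"
      by (subst sum.atLeastLessThan_concat[of 0 "n - i" n, symmetric]) auto
  qed
  also have "\<dots> = (\<Sum>l=0..<n. \<Sum>i=0..<n. if i < n - l then ?q l else (cmod r)\<^sup>2 * ?q l)"
    by (subst sum.swap) (intro sum.cong, auto)
  also have "\<dots> = (\<Sum>l=0..<n. (real (n - l) + real l * (cmod r)\<^sup>2) * ?q l)"
  proof (intro sum.cong refl)
    fix l assume "l \<in> {0..<n}"
    thus "(\<Sum>i=0..<n. if i < n - l then ?q l else (cmod r)\<^sup>2 * ?q l)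
        = (real (n - l) + real l * (cmod r)\<^sup>2) * ?q l"
      by (subst sum.atLeastLessThan_concat[of 0 "n - l" n, symmetric]) (auto simp: algebra_simps)
  qed
  finally show ?thesis .
qed

theorem theorem2:
  fixes k n :: nat and r :: complex
  assumes "k \<ge> 1" and "n \<ge> 2"
  defines "P \<equiv> r_circulant n r (\<lambda>i. of_nat (pell_trib k i))"
  shows "sqrt (real (S2 k (n - 1)) + ((cmod r)\<^sup>2 - 1) / real n * real (W2 k (n - 1)))
           \<le> spectral_norm P
       \<and> spectral_norm P \<le> max (cmod r) 1 * real (S1 k (n - 1))"
proof
  have n: "n > 0" using assms by simp
  have ivl: "{0..n - 1} = {0..<n}" using n by auto
  \<comment> \<open>The weight \<open>n - l + l * (cmod r)\<^sup>2\<close> equals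
    \<open>n + l * ((cmod r)\<^sup>2 - 1)\<close>; divided by \<open>n\<close>, its two summands
    yield \<open>S2\<close> and \<open>W2\<close>.\<close>
  have "(\<Sum>i=0..<n. \<Sum>j=0..<n. (cmod (P $$ (i, j)))\<^sup>2) / real n
      = (\<Sum>l=0..<n. (real (pell_trib k l))\<^sup>2
          + ((cmod r)\<^sup>2 - 1) / real n * (real l * (real (pell_trib k l))\<^sup>2))"
    unfolding P_def frobenius_r_circulant sum_divide_distrib
    using n by (intro sum.cong refl) (simp add: of_nat_diff field_simps)
  also have "\<dots> = real (S2 k (n - 1)) + ((cmod r)\<^sup>2 - 1) / real n * real (W2 k (n - 1))"
    unfolding S2_def W2_def ivl by (simp add: sum.distrib sum_distrib_left)
  finally show "sqrt (real (S2 k (n - 1)) + ((cmod r)\<^sup>2 - 1) / real n * real (W2 k (n - 1)))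
      \<le> spectral_norm P"
    using spectral_norm_ge_frobenius[OF r_circulant_carrier n] unfolding P_def by metis
  show "spectral_norm P \<le> max (cmod r) 1 * real (S1 k (n - 1))"
    using spectral_norm_r_circulant_le[OF n, of r "\<lambda>i. of_nat (pell_trib k i)"]
    unfolding P_def S1_def ivl by simp
qed

end
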